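(* Let $(X,\tau)$ and $(Y,\sigma)$ be topological spaces and let $f \colon (X,\tau) \rightarrow (Y,\sigma)$ be a function. The following conditions are equivalent: (1) $f$ is completely continuous. (2) $f$ is precontinuous, simply-continuous and contra-sg-continuous.
   Context: No separation axioms are assumed and functions are not assumed continuous. For a subset $A$ of a topological space, $\mathrm{Int}(A)$ and $\mathrm{Cl}(A)$ denote interior and closure. $A$ is semi-open if $A \subseteq \mathrm{Cl}(\mathrm{Int}(A))$; semi-closed if its complement is semi-open (equivalently $\mathrm{Int}(\mathrm{Cl}(A)) \subseteq A$); regular open if $A = \mathrm{Int}(\mathrm{Cl}(A))$; preopen if $A \subseteq \mathrm{Int}(\mathrm{Cl}(A))$. $A$ is simply-open if $A = U \cup N$ with $U$ open and $N$ nowhere dense. The semi-closure $\mathrm{sCl}(A)$ is the intersection of all semi-closed sets containing $A$. $A$ is sg-closed if $\mathrm{sCl}(A) \subseteq U$ whenever $A \subseteq U$ and $U$ is semi-open. A function $f \colon (X,\tau)\to(Y,\sigma)$ is completely continuous (resp. precontinuous, simply-continuous, contra-sg-continuous) if the preimage of every open subset of $Y$ is regular open (resp. preopen, simply-open, sg-closed) in $X$. *)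

theory Defs
  imports "HOL-Analysis.Abstract_Topology"
begin

definition semi_open_in :: "'a topology \<Rightarrow> 'a set \<Rightarrow> bool" where
  "semi_open_in X A \<longleftrightarrow> A \<subseteq> topspace X \<and> A \<subseteq> X closure_of (X interior_of A)"

definition semi_closed_in :: "'a topology \<Rightarrow> 'a set \<Rightarrow> bool" where
  "semi_closed_in X A \<longleftrightarrow> A \<subseteq> topspace X \<and> semi_open_in X (topspace X - A)"

definition regular_open_in :: "'a topology \<Rightarrow> 'a set \<Rightarrow> bool" where
  "regular_open_in X A \<longleftrightarrow> A \<subseteq> topspace X \<and> A = X interior_of (X closure_of A)"

definition preopen_in :: "'a topology \<Rightarrow> 'a set \<Rightarrow> bool" where
  "preopen_in X A \<longleftrightarrow> A \<subseteq> topspace X \<and> A \<subseteq> X interior_of (X closure_of A)"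

definition nowhere_dense_in :: "'a topology \<Rightarrow> 'a set \<Rightarrow> bool" where
  "nowhere_dense_in X N \<longleftrightarrow> N \<subseteq> topspace X \<and> X interior_of (X closure_of N) = {}"

definition simply_open_in :: "'a topology \<Rightarrow> 'a set \<Rightarrow> bool" where
  "simply_open_in X A \<longleftrightarrow> (\<exists>U N. openin X U \<and> nowhere_dense_in X N \<and> A = U \<union> N)"

(* For A \<subseteq> topspace X the intersected family contains topspace X, so it is never empty. *)
definition semi_closure_of :: "'a topology \<Rightarrow> 'a set \<Rightarrow> 'a set" (infixr "semi'_closure'_of" 80) where
  "X semi_closure_of A = \<Inter>{C. semi_closed_in X C \<and> A \<subseteq> C}"

definition sg_closed_in :: "'a topology \<Rightarrow> 'a set \<Rightarrow> bool" where
  "sg_closed_in X A \<longleftrightarrow> A \<subseteq> topspace X \<and>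
     (\<forall>U. semi_open_in X U \<and> A \<subseteq> U \<longrightarrow> X semi_closure_of A \<subseteq> U)"

(* Unlike continuous_map, the following predicates constrain only preimages; that f maps
   topspace X into topspace Y has to be assumed separately. *)
definition completely_continuous :: "'a topology \<Rightarrow> 'b topology \<Rightarrow> ('a \<Rightarrow> 'b) \<Rightarrow> bool" where
  "completely_continuous X Y f \<longleftrightarrow>
     (\<forall>V. openin Y V \<longrightarrow> regular_open_in X {x \<in> topspace X. f x \<in> V})"

definition precontinuous :: "'a topology \<Rightarrow> 'b topology \<Rightarrow> ('a \<Rightarrow> 'b) \<Rightarrow> bool" where
  "precontinuous X Y f \<longleftrightarrow>
     (\<forall>V. openin Y V \<longrightarrow> preopen_in X {x \<in> topspace X. f x \<in> V})"

definition simply_continuous :: "'a topology \<Rightarrow> 'b topology \<Rightarrow> ('a \<Rightarrow> 'b) \<Rightarrow> bool" where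
  "simply_continuous X Y f \<longleftrightarrow>
     (\<forall>V. openin Y V \<longrightarrow> simply_open_in X {x \<in> topspace X. f x \<in> V})"

definition contra_sg_continuous :: "'a topology \<Rightarrow> 'b topology \<Rightarrow> ('a \<Rightarrow> 'b) \<Rightarrow> bool" where
  "contra_sg_continuous X Y f \<longleftrightarrow>
     (\<forall>V. openin Y V \<longrightarrow> sg_closed_in X {x \<in> topspace X. f x \<in> V})"

end

theory Submission
  imports Defs
begin

text \<open>The equivalence holds set by set. A regular open set is open and semi-closed, hence equal to
  its semi-closure. Conversely, a nowhere dense set cannot contribute interior points to the closure
  of \<open>U \<union> N\<close>, so a preopen simply-open set is semi-open; if it is also sg-closed, it may be used as
  its own semi-open neighbourhood, so it is semi-closed, and preopen semi-closed sets are regular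
  open.\<close>

text \<open>Complementation exchanges interior and closure. The resulting condition is monotone in
  the closed set and comparable with preopenness.\<close>

lemma semi_closed_in_iff:
  "semi_closed_in X A \<longleftrightarrow> A \<subseteq> topspace X \<and> X interior_of (X closure_of A) \<subseteq> A"
  using interior_of_subset_topspace[of X "X closure_of A"]
  by (auto simp: semi_closed_in_def semi_open_in_def interior_of_complement closure_of_complement)

lemma subset_semi_closure_of: "A \<subseteq> X semi_closure_of A"
  by (auto simp: semi_closure_of_def)

lemma semi_closure_of_minimal:
  "semi_closed_in X C \<Longrightarrow> A \<subseteq> C \<Longrightarrow> X semi_closure_of A \<subseteq> C"
  by (auto simp: semi_closure_of_def)

text \<open>Interior of closure is monotone, so its value at an intersection of semi-closed sets
  lies in every member, hence in the intersection.\<close>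

lemma semi_closed_in_semi_closure_of:
  assumes "A \<subseteq> topspace X"
  shows "semi_closed_in X (X semi_closure_of A)"
proof -
  \<comment> \<open>The whole space belongs to the intersected family, which keeps the semi-closure
    inside \<open>topspace X\<close>.\<close>
  have "semi_closed_in X (topspace X)"
    by (simp add: semi_closed_in_iff)
  then have "X semi_closure_of A \<subseteq> topspace X"
    using assms by (rule semi_closure_of_minimal)
  moreover have "X interior_of (X closure_of (X semi_closure_of A)) \<subseteq> C"
    if C: "semi_closed_in X C" "A \<subseteq> C" for C
    using interior_of_mono[OF closure_of_mono[OF semi_closure_of_minimal[OF C]]] C(1)
    unfolding semi_closed_in_iff by blast
  then have "X interior_of (X closure_of (X semi_closure_of A)) \<subseteq> X semi_closure_of A"
    unfolding semi_closure_of_def[of X A] by blast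
  ultimately show ?thesis
    by (simp add: semi_closed_in_iff)
qed

lemma semi_closed_imp_sg_closed: "semi_closed_in X A \<Longrightarrow> sg_closed_in X A"
  using semi_closure_of_minimal[of X A A] by (auto simp: sg_closed_in_def semi_closed_in_def)

lemma semi_open_sg_closed_imp_semi_closed:
  assumes "semi_open_in X A" "sg_closed_in X A"
  shows "semi_closed_in X A"
proof -
  have "X semi_closure_of A = A"
    using assms subset_semi_closure_of[of A X] by (auto simp: sg_closed_in_def)
  then show ?thesis
    using semi_closed_in_semi_closure_of[of A X] assms(1) by (simp add: semi_open_in_def)
qed

text \<open>Removing the closed set \<open>X closure_of U\<close> from the left side leaves an open
  set inside \<open>X closure_of N\<close>, and such a set is empty.\<close>

lemma interior_of_closure_of_Un_nowhere_dense:
  assumes "nowhere_dense_in X N"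
  shows "X interior_of (X closure_of (U \<union> N)) \<subseteq> X closure_of U"
proof -
  let ?W = "X interior_of (X closure_of (U \<union> N)) - X closure_of U"
  have "openin X ?W"
    by (simp add: openin_diff)
  moreover have "?W \<subseteq> X closure_of N"
    using interior_of_subset[of X "X closure_of (U \<union> N)"] by (auto simp: closure_of_Un)
  ultimately have "?W \<subseteq> X interior_of (X closure_of N)"
    by (rule interior_of_maximal[rotated])
  then show ?thesis
    using assms by (auto simp: nowhere_dense_in_def)
qed

lemma preopen_simply_open_imp_semi_open:
  assumes "preopen_in X A" "simply_open_in X A"
  shows "semi_open_in X A"
proof -
  obtain U N where U: "openin X U" "nowhere_dense_in X N" "A = U \<union> N"
    using assms(2) unfolding simply_open_in_def by blast
  \<comment> \<open>Preopenness places all of \<open>A\<close>, including the points of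
    \<open>N\<close>, in the interior of the closure of \<open>U \<union> N\<close>.\<close>
  have "A \<subseteq> X closure_of U"
    using assms(1) interior_of_closure_of_Un_nowhere_dense[OF U(2), of U] U(3)
    unfolding preopen_in_def by blast
  \<comment> \<open>\<open>U\<close> is an open subset of \<open>A\<close>, so it lies in the
    interior of \<open>A\<close>.\<close>
  also have "\<dots> \<subseteq> X closure_of (X interior_of A)"
    using U by (intro closure_of_mono interior_of_maximal) auto
  finally show ?thesis
    using assms(1) by (simp add: semi_open_in_def preopen_in_def)
qed

lemma regular_open_in_iff:
  "regular_open_in X A \<longleftrightarrow> preopen_in X A \<and> simply_open_in X A \<and> sg_closed_in X A"
proof
  assume A: "regular_open_in X A"
  then have "openin X A"
    unfolding regular_open_in_def by (metis openin_interior_of)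
  then have "simply_open_in X A"
    unfolding simply_open_in_def nowhere_dense_in_def
    by (intro exI[of _ A] exI[of _ "{}"]) simp
  moreover have "semi_closed_in X A"
    using A by (auto simp: regular_open_in_def semi_closed_in_iff)
  ultimately show "preopen_in X A \<and> simply_open_in X A \<and> sg_closed_in X A"
    using A by (auto simp: regular_open_in_def preopen_in_def intro: semi_closed_imp_sg_closed)
next
  assume A: "preopen_in X A \<and> simply_open_in X A \<and> sg_closed_in X A"
  then have "semi_closed_in X A"
    by (intro semi_open_sg_closed_imp_semi_closed preopen_simply_open_imp_semi_open) auto
  \<comment> \<open>Preopen and semi-closed give the two opposite inclusions between
    \<open>A\<close> and the interior of its closure.\<close>
  then show "regular_open_in X A"
    using A by (auto simp: regular_open_in_def preopen_in_def semi_closed_in_iff)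
qed

theorem corollary3p22:
  fixes X :: "'a topology" and Y :: "'b topology" and f :: "'a \<Rightarrow> 'b"
  assumes "f \<in> topspace X \<rightarrow> topspace Y"
  shows "completely_continuous X Y f \<longleftrightarrow>
    precontinuous X Y f \<and> simply_continuous X Y f \<and> contra_sg_continuous X Y f"
  \<comment> \<open>Applying the set-level equivalence to each preimage leaves only the distribution
    of a universal quantifier over a conjunction.\<close>
  unfolding completely_continuous_def precontinuous_def simply_continuous_def
    contra_sg_continuous_def regular_open_in_iff
  by blast

end
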